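(* Let $n$ be a positive integer and let $\gamma_1,\gamma_2:S^n\to\mathbb{R}_+$ be convex integrands. Define $\gamma_{max},\gamma_{min}:S^n\to\mathbb{R}_+$ by $\gamma_{max}(\theta)=\max\{\gamma_1(\theta),\gamma_2(\theta)\}$ and $\gamma_{min}(\theta)=\min\{\gamma_1(\theta),\gamma_2(\theta)\}$. Suppose that $\mathcal{W}_{\gamma_1}$ is the dual Wulff shape of $\mathcal{W}_{\gamma_2}$, i.e. $\mathcal{W}_{\gamma_1}=\mathcal{D}\mathcal{W}_{\gamma_2}$. Then $\mathcal{W}_{\gamma_{max}}$ is the dual Wulff shape of $\mathcal{W}_{\gamma_{min}}$, i.e. $\mathcal{W}_{\gamma_{max}}=\mathcal{D}\mathcal{W}_{\gamma_{min}}$.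
   Context: $S^n$ is the unit sphere in $\mathbb{R}^{n+1}$ and $\mathbb{R}_+$ is the set of positive real numbers. For a continuous function $\gamma:S^n\to\mathbb{R}_+$, the Wulff shape associated with $\gamma$ is $\mathcal{W}_\gamma=\bigcap_{\theta\in S^n}\{x\in\mathbb{R}^{n+1}\mid x\cdot\theta\le\gamma(\theta)\}$, where $\cdot$ is the dot product. Write $\mathrm{graph}(\gamma)=\{(\theta,\gamma(\theta))\mid\theta\in S^n\}\subset\mathbb{R}^{n+1}\setminus\{0\}$ in polar plot expression, i.e. $(\theta,r)$ with $\theta\in S^n$, $r>0$ denotes the point $r\theta\in\mathbb{R}^{n+1}\setminus\{0\}$. The inversion $\mathrm{inv}:\mathbb{R}^{n+1}\setminus\{0\}\to\mathbb{R}^{n+1}\setminus\{0\}$ is $\mathrm{inv}(\theta,r)=(-\theta,1/r)$. A continuous function $\gamma:S^n\to\mathbb{R}_+$ is called a convex integrand if $\mathrm{inv}(\mathrm{graph}(\gamma))$ equals the boundary of the convex hull of $\mathrm{inv}(\mathrm{graph}(\gamma))$. Dual Wulff shape. For $\widetilde P\in S^{n+1}\subset\mathbb{R}^{n+2}$ let $H(\widetilde P)=\{\widetilde Q\in S^{n+1}\mid\widetilde P\cdot\widetilde Q\ge0\}$, and for non-empty $\widetilde W\subset S^{n+1}$ let $\widetilde W^\circ=\bigcap_{\widetilde P\in\widetilde W}H(\widetilde P)$ (spherical polar set). Let $N=(0,\dots,0,1)\in\mathbb{R}^{n+2}$, $S^{n+1}_{N,+}=S^{n+1}\setminus H(-N)$,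 $Id:\mathbb{R}^{n+1}\to\mathbb{R}^{n+1}\times\{1\}$, $Id(x)=(x,1)$, and let $\alpha_N:S^{n+1}_{N,+}\to\mathbb{R}^{n+1}\times\{1\}$ be the central projection $\alpha_N(P_1,\dots,P_{n+2})=(P_1/P_{n+2},\dots,P_{n+1}/P_{n+2},1)$. The dual Wulff shape of a Wulff shape $\mathcal{W}\subset\mathbb{R}^{n+1}$ is \[\mathcal{D}\mathcal{W}=Id^{-1}\circ\alpha_N\left(\left(\alpha_N^{-1}\circ Id(\mathcal{W})\right)^\circ\right),\] which is known to be again a Wulff shape. *)

theory Defs
  imports "HOL-Analysis.Analysis"
begin

text \<open>
  The space \<open>real ^ 'n\<close> with \<open>CARD('n) = n + 1\<close> plays the role of R^(n+1), and
  \<open>(real ^ 'n) \<times> real\<close>, with the inner product of the product type, that of R^(n+2).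
  Functions on the sphere S^n are total functions on \<open>real ^ 'n\<close>; only their values
  on \<open>sphere 0 1\<close> are ever used.
\<close>

definition pos_cont_on_sphere :: "(real ^ 'n \<Rightarrow> real) \<Rightarrow> bool" where
  "pos_cont_on_sphere \<gamma> \<longleftrightarrow>
     continuous_on (sphere 0 1) \<gamma> \<and> (\<forall>\<theta>\<in>sphere 0 1. 0 < \<gamma> \<theta>)"

definition wulff_shape :: "(real ^ 'n \<Rightarrow> real) \<Rightarrow> (real ^ 'n) set" where
  "wulff_shape \<gamma> = (\<Inter>\<theta>\<in>sphere 0 1. {x. x \<bullet> \<theta> \<le> \<gamma> \<theta>})"

definition polar_graph :: "(real ^ 'n \<Rightarrow> real) \<Rightarrow> (real ^ 'n) set" where
  "polar_graph \<gamma> = (\<lambda>\<theta>. \<gamma> \<theta> *\<^sub>R \<theta>) ` sphere 0 1"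

text \<open>
  A point \<open>x \<noteq> 0\<close> has polar coordinates \<open>(sgn x, norm x)\<close>, where \<open>sgn x = x /\<^sub>R norm x\<close>;
  the inversion sends \<open>(\<theta>, r)\<close> to \<open>(- \<theta>, 1 / r)\<close>.
\<close>

definition polar_inversion :: "real ^ 'n \<Rightarrow> real ^ 'n" where
  "polar_inversion x = (1 / norm x) *\<^sub>R (- sgn x)"

definition convex_integrand :: "(real ^ 'n \<Rightarrow> real) \<Rightarrow> bool" where
  "convex_integrand \<gamma> \<longleftrightarrow>
     pos_cont_on_sphere \<gamma> \<and>
     polar_inversion ` polar_graph \<gamma> =
       frontier (convex hull (polar_inversion ` polar_graph \<gamma>))"

definition hemisphere :: "(real ^ 'n) \<times> real \<Rightarrow> ((real ^ 'n) \<times> real) set" where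
  "hemisphere P = {Q \<in> sphere 0 1. 0 \<le> P \<bullet> Q}"

definition spherical_polar :: "((real ^ 'n) \<times> real) set \<Rightarrow> ((real ^ 'n) \<times> real) set" where
  "spherical_polar W = (\<Inter>P\<in>W. hemisphere P)"

definition north_pole :: "(real ^ 'n) \<times> real" where
  "north_pole = (0, 1)"

definition open_north_hemisphere :: "((real ^ 'n) \<times> real) set" where
  "open_north_hemisphere = sphere 0 1 - hemisphere (- north_pole)"

definition lift_one :: "real ^ 'n \<Rightarrow> (real ^ 'n) \<times> real" where
  "lift_one x = (x, 1)"

text \<open>The central projection; meaningful only on \<open>open_north_hemisphere\<close>.\<close>

definition central_projection :: "(real ^ 'n) \<times> real \<Rightarrow> (real ^ 'n) \<times> real" where
  "central_projection P = ((1 / snd P) *\<^sub>R fst P, 1)"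

text \<open>
  The inverses of \<open>lift_one\<close> and \<open>central_projection\<close> are applied to sets only, so they
  are preimages, and \<open>central_projection\<close> is restricted to its domain
  \<open>open_north_hemisphere\<close> in both directions. For a Wulff shape, which contains a
  neighbourhood of 0, the polar set already lies in that domain.
\<close>

definition dual_wulff_shape :: "(real ^ 'n) set \<Rightarrow> (real ^ 'n) set" where
  "dual_wulff_shape W =
     lift_one -` (central_projection `
       (spherical_polar (open_north_hemisphere \<inter> central_projection -` (lift_one ` W))
         \<inter> open_north_hemisphere))"

end

theory Submission imports Defs begin

text \<open>
  In the affine chart \<open>(x, 1)\<close> the spherical polar becomes the condition \<open>x \<bullet> y \<ge> -1\<close>,
  because \<open>(x, 1) \<bullet> (y, 1) = x \<bullet> y + 1\<close>. So the dual Wulff shape of \<open>W\<close> is the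
  reflected polar set \<open>W\<degree> = {y. \<forall>x\<in>W. x \<bullet> y \<ge> -1}\<close> (\<open>dual_wulff_shape_eq\<close>).

  For a convex integrand \<open>\<gamma>\<close> let \<open>B \<gamma>\<close> be the convex hull of the inverted graph, that is, of
  the points \<open>- \<theta> / \<gamma> \<theta>\<close>. The inequalities that define the Wulff shape say precisely that
  \<open>W \<gamma> = (B \<gamma>)\<degree>\<close>, and the bipolar theorem gives \<open>(W \<gamma>)\<degree> = B \<gamma>\<close>
  (\<open>antipolar_wulff_shape\<close>). The hypothesis \<open>W \<gamma>1 = (W \<gamma>2)\<degree>\<close> therefore means
  \<open>W \<gamma>1 = B \<gamma>2\<close>, and, applying the polar once more, \<open>W \<gamma>2 = B \<gamma>1\<close>. Consequently
  \<open>W \<gamma>min = W \<gamma>1 \<inter> W \<gamma>2 = B \<gamma>1 \<inter> B \<gamma>2\<close>.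

  By convexity of the integrand, \<open>B \<gamma>\<close> reaches exactly the distance \<open>1 / \<gamma> \<theta>\<close> from the origin
  in the direction \<open>- \<theta>\<close> (\<open>inversion_hull_radial\<close>). The intersection
  \<open>B \<gamma>1 \<inter> B \<gamma>2\<close> hence reaches the distance \<open>1 / max (\<gamma>1 \<theta>) (\<gamma>2 \<theta>)\<close>, and
  since the polar of a set star-shaped about the origin depends on the radial endpoints only,
  \<open>(B \<gamma>1 \<inter> B \<gamma>2)\<degree> = W \<gamma>max\<close> (\<open>antipolar_inter_inversion_hull\<close>).
\<close>

section \<open>The dual Wulff shape as a reflected polar set\<close>

definition antipolar :: "'a::real_inner set \<Rightarrow> 'a set" where
  "antipolar A = {y. \<forall>x\<in>A. - 1 \<le> x \<bullet> y}"

lemma mem_open_north_hemisphere: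
  "P \<in> open_north_hemisphere \<longleftrightarrow> norm P = 1 \<and> 0 < snd P"
  by (cases P) (auto simp: open_north_hemisphere_def hemisphere_def north_pole_def)

lemma normalized_lift_one:
  fixes x :: "real ^ 'n"
  defines "P \<equiv> (1 / norm (lift_one x)) *\<^sub>R lift_one x"
  shows "P \<in> open_north_hemisphere" and "central_projection P = lift_one x"
proof -
  have pos: "0 < norm (lift_one x)" by (simp add: lift_one_def zero_prod_def)
  then have "norm P = 1" unfolding P_def by simp
  moreover have "snd P = 1 / norm (lift_one x)" by (simp add: P_def lift_one_def)
  ultimately show "P \<in> open_north_hemisphere"
    using pos by (simp add: mem_open_north_hemisphere)
  show "central_projection P = lift_one x"
    using pos by (simp add: P_def central_projection_def lift_one_def)
qed

text \<open>
  Central projection scales each point of the open hemisphere by the positive factor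
  \<open>1 / snd P\<close>, so it does not affect the sign of an inner product.
\<close>

lemma inner_nonneg_iff_central_projection:
  assumes "P \<in> open_north_hemisphere" "Q \<in> open_north_hemisphere"
    and "central_projection P = lift_one x" "central_projection Q = lift_one y"
  shows "0 \<le> P \<bullet> Q \<longleftrightarrow> - 1 \<le> x \<bullet> y"
proof -
  have pos: "0 < snd P" "0 < snd Q"
    using assms(1,2) by (auto simp: mem_open_north_hemisphere)
  have "fst P = snd P *\<^sub>R x" "fst Q = snd Q *\<^sub>R y"
    using assms(3,4) pos by (auto simp: central_projection_def lift_one_def)
  then have "P \<bullet> Q = (snd P * snd Q) * (x \<bullet> y + 1)"
    by (simp add: inner_prod_def algebra_simps)
  moreover have "0 < snd P * snd Q" using pos by simp
  ultimately have "0 \<le> P \<bullet> Q \<longleftrightarrow> 0 \<le> x \<bullet> y + 1"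
    using mult_le_cancel_left_pos[of "snd P * snd Q" 0 "x \<bullet> y + 1"] by simp
  then show ?thesis by linarith
qed

lemma dual_wulff_shape_eq: "dual_wulff_shape W = antipolar W"
proof (intro equalityI subsetI)
  fix y assume "y \<in> dual_wulff_shape W"
  then obtain Q where Q: "Q \<in> open_north_hemisphere" "central_projection Q = lift_one y"
    and pol: "Q \<in> spherical_polar (open_north_hemisphere \<inter> central_projection -` (lift_one ` W))"
    by (auto simp: dual_wulff_shape_def)
  have "- 1 \<le> x \<bullet> y" if "x \<in> W" for x
  proof -
    let ?P = "(1 / norm (lift_one x)) *\<^sub>R lift_one x"
    note P = normalized_lift_one[of x]
    have "Q \<in> hemisphere ?P"
      using pol P that unfolding spherical_polar_def by blast
    then have "0 \<le> ?P \<bullet> Q" unfolding hemisphere_def by blast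
    then show ?thesis using inner_nonneg_iff_central_projection[OF P(1) Q(1) P(2) Q(2)] by blast
  qed
  then show "y \<in> antipolar W" by (auto simp: antipolar_def)
next
  fix y assume y: "y \<in> antipolar W"
  let ?Q = "(1 / norm (lift_one y)) *\<^sub>R lift_one y"
  note Q = normalized_lift_one[of y]
  have "?Q \<in> hemisphere P"
    if P: "P \<in> open_north_hemisphere" and PW: "central_projection P \<in> lift_one ` W" for P
  proof -
    from PW obtain x where x: "x \<in> W" "central_projection P = lift_one x" by blast
    have "- 1 \<le> x \<bullet> y" using y x(1) by (auto simp: antipolar_def)
    then have "0 \<le> P \<bullet> ?Q"
      using inner_nonneg_iff_central_projection[OF P Q(1) x(2) Q(2)] by blast
    moreover have "?Q \<in> sphere 0 1" using Q(1) unfolding mem_open_north_hemisphere by simp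
    ultimately show ?thesis unfolding hemisphere_def by blast
  qed
  then have "?Q \<in> spherical_polar (open_north_hemisphere \<inter> central_projection -` (lift_one ` W))"
    by (auto simp: spherical_polar_def)
  then show "y \<in> dual_wulff_shape W"
    unfolding dual_wulff_shape_def using Q(1) Q(2)[symmetric] by blast
qed

section \<open>Half-spaces and the bipolar theorem\<close>

text \<open>The antipolar set is an intersection of half-spaces, so it ignores convex hulls.\<close>

lemma antipolar_convex_hull: "antipolar (convex hull A) = antipolar A"
proof (intro equalityI subsetI)
  fix y assume "y \<in> antipolar A"
  then have "A \<subseteq> {x. y \<bullet> x \<ge> - 1}" by (auto simp: antipolar_def inner_commute)
  then have "convex hull A \<subseteq> {x. y \<bullet> x \<ge> - 1}"
    by (rule hull_minimal) (rule convex_halfspace_ge)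
  then show "y \<in> antipolar (convex hull A)" by (auto simp: antipolar_def inner_commute)
qed (auto simp: antipolar_def hull_inc)

text \<open>
  The bipolar theorem: a point outside \<open>S\<close> is cut off by a hyperplane that misses the origin,
  and its normal vector can be scaled so that the hyperplane is \<open>{x. x \<bullet> a = -1}\<close>.
\<close>

lemma antipolar_antipolar:
  fixes S :: "'a::euclidean_space set"
  assumes "convex S" "closed S" "0 \<in> S"
  shows "antipolar (antipolar S) = S"
proof (intro equalityI subsetI)
  fix y assume y: "y \<in> antipolar (antipolar S)"
  show "y \<in> S"
  proof (rule ccontr)
    assume "y \<notin> S"
    then obtain a b where ab: "a \<bullet> y < b" "\<forall>x\<in>S. b < a \<bullet> x"
      using separating_hyperplane_closed_point[OF assms(1,2)] by blast
    have b: "b < 0" using ab(2) assms(3) by force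
    let ?a = "(1 / (- b)) *\<^sub>R a"
    have "- 1 \<le> x \<bullet> ?a" if "x \<in> S" for x
      using ab(2) that b by (auto simp: inner_commute[of x] field_simps intro: less_imp_le)
    then have "?a \<in> antipolar S" by (auto simp: antipolar_def)
    then have "- 1 \<le> ?a \<bullet> y" using y unfolding antipolar_def by blast
    then show False using ab(1) b by (simp add: field_simps)
  qed
qed (auto simp: antipolar_def inner_commute)

section \<open>The convex hull of the inverted graph\<close>

definition inversion_hull :: "(real ^ 'n \<Rightarrow> real) \<Rightarrow> (real ^ 'n) set" where
  "inversion_hull \<gamma> = convex hull (polar_inversion ` polar_graph \<gamma>)"

lemma polar_inversion_polar_graph:
  assumes "pos_cont_on_sphere \<gamma>"
  shows "polar_inversion ` polar_graph \<gamma> = (\<lambda>\<theta>. - ((1 / \<gamma> \<theta>) *\<^sub>R \<theta>)) ` sphere 0 1"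
  unfolding polar_graph_def image_image
proof (rule image_cong[OF refl])
  fix \<theta> :: "real ^ 'a" assume "\<theta> \<in> sphere 0 1"
  then have "0 < \<gamma> \<theta>" "norm \<theta> = 1" using assms by (auto simp: pos_cont_on_sphere_def)
  then show "polar_inversion (\<gamma> \<theta> *\<^sub>R \<theta>) = - ((1 / \<gamma> \<theta>) *\<^sub>R \<theta>)"
    by (simp add: polar_inversion_def sgn_div_norm)
qed

lemma inversion_hull_endpoint:
  assumes "pos_cont_on_sphere \<gamma>" "\<theta> \<in> sphere 0 1"
  shows "- ((1 / \<gamma> \<theta>) *\<^sub>R \<theta>) \<in> inversion_hull \<gamma>"
  unfolding inversion_hull_def polar_inversion_polar_graph[OF assms(1)]
  using assms(2) by (intro hull_inc imageI)

lemma compact_inversion_hull: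
  assumes "pos_cont_on_sphere \<gamma>"
  shows "compact (inversion_hull \<gamma>)"
  unfolding inversion_hull_def polar_inversion_polar_graph[OF assms]
  using assms
  by (intro compact_convex_hull compact_continuous_image continuous_intros)
    (auto simp: pos_cont_on_sphere_def)

lemma wulff_shape_eq_antipolar:
  assumes "pos_cont_on_sphere \<gamma>"
  shows "wulff_shape \<gamma> = antipolar (inversion_hull \<gamma>)"
proof -
  have "x \<bullet> \<theta> \<le> \<gamma> \<theta> \<longleftrightarrow> - 1 \<le> - ((1 / \<gamma> \<theta>) *\<^sub>R \<theta>) \<bullet> x" if "\<theta> \<in> sphere 0 1" for x \<theta>
  proof -
    have "0 < \<gamma> \<theta>" using assms that by (auto simp: pos_cont_on_sphere_def)
    then show ?thesis by (simp add: inner_commute[of \<theta>] field_simps)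
  qed
  then show ?thesis
    unfolding inversion_hull_def antipolar_convex_hull polar_inversion_polar_graph[OF assms]
    by (auto simp: wulff_shape_def antipolar_def)
qed

text \<open>The inverted graph has points in two opposite directions, with the origin between them.\<close>

lemma zero_mem_inversion_hull:
  fixes \<gamma> :: "real ^ 'n \<Rightarrow> real"
  assumes "pos_cont_on_sphere \<gamma>"
  shows "0 \<in> inversion_hull \<gamma>"
proof -
  obtain \<theta> :: "real ^ 'n" where \<theta>: "\<theta> \<in> sphere 0 1"
    using vector_choose_size[of 1] by auto
  define p where "p = \<gamma> \<theta>"
  define q where "q = \<gamma> (- \<theta>)"
  have pos: "0 < p" "0 < q"
    using assms \<theta> by (auto simp: pos_cont_on_sphere_def p_def q_def)
  have "- ((1 / p) *\<^sub>R \<theta>) \<in> inversion_hull \<gamma>" "(1 / q) *\<^sub>R \<theta> \<in> inversion_hull \<gamma>"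
    using inversion_hull_endpoint[OF assms \<theta>] inversion_hull_endpoint[OF assms, of "- \<theta>"] \<theta>
    by (auto simp: p_def q_def)
  moreover have "convex (inversion_hull \<gamma>)" by (simp add: inversion_hull_def)
  ultimately have "(p / (p + q)) *\<^sub>R - ((1 / p) *\<^sub>R \<theta>) + (q / (p + q)) *\<^sub>R ((1 / q) *\<^sub>R \<theta>)
      \<in> inversion_hull \<gamma>"
    using pos by (intro convexD) (auto simp: add_divide_distrib[symmetric])
  then show ?thesis using pos by simp
qed

lemma radial_segment_subset_inversion_hull:
  assumes "pos_cont_on_sphere \<gamma>" "\<theta> \<in> sphere 0 1" "0 \<le> t" "t * \<gamma> \<theta> \<le> 1"
  shows "- (t *\<^sub>R \<theta>) \<in> inversion_hull \<gamma>"
proof -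
  have pos: "0 < \<gamma> \<theta>" using assms by (auto simp: pos_cont_on_sphere_def)
  have "convex (inversion_hull \<gamma>)" by (simp add: inversion_hull_def)
  then have "(t * \<gamma> \<theta>) *\<^sub>R - ((1 / \<gamma> \<theta>) *\<^sub>R \<theta>) + (1 - t * \<gamma> \<theta>) *\<^sub>R 0 \<in> inversion_hull \<gamma>"
    using assms pos
    by (intro convexD inversion_hull_endpoint zero_mem_inversion_hull) auto
  then show ?thesis using pos by simp
qed

text \<open>
  As \<open>\<gamma>\<close> is bounded above on the sphere, the radial segments of the hull have lengths bounded
  away from zero.
\<close>

lemma zero_mem_interior_inversion_hull:
  assumes "pos_cont_on_sphere \<gamma>"
  shows "0 \<in> interior (inversion_hull \<gamma>)"
proof -
  have "compact (\<gamma> ` sphere 0 1)"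
    using assms by (intro compact_continuous_image) (auto simp: pos_cont_on_sphere_def)
  then obtain M where "0 < M" "\<forall>r\<in>\<gamma> ` sphere 0 1. norm r \<le> M"
    using compact_imp_bounded bounded_pos by blast
  then have M: "0 < M" "\<And>\<theta>. \<theta> \<in> sphere 0 1 \<Longrightarrow> \<bar>\<gamma> \<theta>\<bar> \<le> M"
    by (auto simp del: mem_sphere)
  have "x \<in> inversion_hull \<gamma>" if x: "norm x < 1 / M" for x
  proof (cases "x = 0")
    case False
    then have \<theta>: "- sgn x \<in> sphere 0 1" by (simp add: norm_sgn)
    have "norm x * \<gamma> (- sgn x) \<le> norm x * M"
      using M(2)[OF \<theta>] by (intro mult_left_mono) auto
    also have "\<dots> \<le> 1" using x M(1) by (simp add: field_simps)
    finally have "- (norm x *\<^sub>R (- sgn x)) \<in> inversion_hull \<gamma>"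
      by (intro radial_segment_subset_inversion_hull[OF assms \<theta>]) auto
    then show ?thesis using False by (simp add: sgn_div_norm)
  qed (use zero_mem_inversion_hull[OF assms] in simp)
  then have "ball 0 (1 / M) \<subseteq> inversion_hull \<gamma>" by auto
  then show ?thesis using M(1)
    by (meson centre_in_ball interior_maximal open_ball subsetD zero_less_divide_1_iff)
qed

text \<open>
  Here convexity of the integrand enters: were a point beyond \<open>- \<theta> / \<gamma> \<theta>\<close> on the same ray in the
  hull, then, as the origin is an interior point, \<open>- \<theta> / \<gamma> \<theta>\<close> would be interior as well,
  whereas the points of the inverted graph lie on the boundary.
\<close>

lemma inversion_hull_radial:
  assumes "convex_integrand \<gamma>" "\<theta> \<in> sphere 0 1" "0 \<le> t"
  shows "- (t *\<^sub>R \<theta>) \<in> inversion_hull \<gamma> \<longleftrightarrow> t * \<gamma> \<theta> \<le> 1"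
proof
  have pc: "pos_cont_on_sphere \<gamma>" using assms(1) by (simp add: convex_integrand_def)
  then show "t * \<gamma> \<theta> \<le> 1 \<Longrightarrow> - (t *\<^sub>R \<theta>) \<in> inversion_hull \<gamma>"
    using radial_segment_subset_inversion_hull assms(2,3) by blast
  have pos: "0 < \<gamma> \<theta>" using pc assms(2) by (auto simp: pos_cont_on_sphere_def)
  assume mem: "- (t *\<^sub>R \<theta>) \<in> inversion_hull \<gamma>"
  show "t * \<gamma> \<theta> \<le> 1"
  proof (rule ccontr)
    assume "\<not> t * \<gamma> \<theta> \<le> 1"
    then have gt: "1 < t * \<gamma> \<theta>" by simp
    then have t: "0 < t" using pos assms(3) by (cases "t = 0") auto
    \<comment> \<open>Shrinking the point \<open>- (t *\<^sub>R \<theta>)\<close> towards the origin by the factor \<open>1 - e\<close> gives \<open>- \<theta> / \<gamma> \<theta>\<close>.\<close>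
    define e where "e = 1 - 1 / (t * \<gamma> \<theta>)"
    have e: "0 < e" "e \<le> 1" using gt by (auto simp: e_def)
    have "- (t *\<^sub>R \<theta>) - e *\<^sub>R (- (t *\<^sub>R \<theta>) - 0) \<in> interior (inversion_hull \<gamma>)"
      by (rule mem_interior_convex_shrink[OF _ zero_mem_interior_inversion_hull[OF pc] mem e])
        (simp add: inversion_hull_def)
    moreover have "- (t *\<^sub>R \<theta>) - e *\<^sub>R (- (t *\<^sub>R \<theta>) - 0) = - ((1 / \<gamma> \<theta>) *\<^sub>R \<theta>)"
    proof -
      have "t - e * t = 1 / \<gamma> \<theta>" using t pos by (simp add: e_def field_simps)
      moreover have "- (t *\<^sub>R \<theta>) - e *\<^sub>R (- (t *\<^sub>R \<theta>) - 0) = - ((t - e * t) *\<^sub>R \<theta>)"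
        by (simp add: algebra_simps)
      ultimately show ?thesis by simp
    qed
    moreover have "- ((1 / \<gamma> \<theta>) *\<^sub>R \<theta>) \<in> frontier (inversion_hull \<gamma>)"
      using assms(1,2) polar_inversion_polar_graph[OF pc]
      unfolding convex_integrand_def inversion_hull_def by blast
    ultimately show False by (simp add: frontier_def)
  qed
qed

lemma antipolar_wulff_shape:
  assumes "pos_cont_on_sphere \<gamma>"
  shows "antipolar (wulff_shape \<gamma>) = inversion_hull \<gamma>"
  unfolding wulff_shape_eq_antipolar[OF assms]
  by (intro antipolar_antipolar zero_mem_inversion_hull compact_imp_closed
      compact_inversion_hull assms) (simp add: inversion_hull_def)

section \<open>Maximum and minimum of two convex integrands\<close>

text \<open>
  The functional \<open>y\<close> is linear along each ray from the origin, so on the intersection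
  of the two hulls it suffices to test it at the farthest point of each ray, which by
  \<open>inversion_hull_radial\<close> is the nearer of the two endpoints \<open>- \<theta> / \<gamma>1 \<theta>\<close> and \<open>- \<theta> / \<gamma>2 \<theta>\<close>.
\<close>

lemma antipolar_inter_inversion_hull:
  fixes \<gamma>1 \<gamma>2 :: "real ^ 'n \<Rightarrow> real"
  assumes ci: "convex_integrand \<gamma>1" "convex_integrand \<gamma>2"
  shows "antipolar (inversion_hull \<gamma>1 \<inter> inversion_hull \<gamma>2) = wulff_shape (\<lambda>\<theta>. max (\<gamma>1 \<theta>) (\<gamma>2 \<theta>))"
proof (intro equalityI subsetI)
  fix y assume y: "y \<in> antipolar (inversion_hull \<gamma>1 \<inter> inversion_hull \<gamma>2)"
  have "y \<bullet> \<theta> \<le> max (\<gamma>1 \<theta>) (\<gamma>2 \<theta>)" if \<theta>: "\<theta> \<in> sphere 0 1" for \<theta>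
  proof -
    let ?m = "max (\<gamma>1 \<theta>) (\<gamma>2 \<theta>)"
    have pos: "0 < ?m"
      using ci(1) \<theta> by (auto simp: convex_integrand_def pos_cont_on_sphere_def less_max_iff_disj)
    then have "- ((1 / ?m) *\<^sub>R \<theta>) \<in> inversion_hull \<gamma>1 \<inter> inversion_hull \<gamma>2"
      using inversion_hull_radial[OF ci(1) \<theta>, of "1 / ?m"]
        inversion_hull_radial[OF ci(2) \<theta>, of "1 / ?m"] by simp
    then have "- 1 \<le> - ((1 / ?m) *\<^sub>R \<theta>) \<bullet> y" using y unfolding antipolar_def by blast
    then show ?thesis using pos by (simp add: inner_commute[of \<theta>] pos_divide_le_eq)
  qed
  then show "y \<in> wulff_shape (\<lambda>\<theta>. max (\<gamma>1 \<theta>) (\<gamma>2 \<theta>))" by (auto simp: wulff_shape_def)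
next
  fix y assume y: "y \<in> wulff_shape (\<lambda>\<theta>. max (\<gamma>1 \<theta>) (\<gamma>2 \<theta>))"
  have "- 1 \<le> x \<bullet> y" if x: "x \<in> inversion_hull \<gamma>1 \<inter> inversion_hull \<gamma>2" for x
  proof (cases "x = 0")
    case False
    define \<theta> where "\<theta> = - sgn x"
    have \<theta>: "\<theta> \<in> sphere 0 1" using False by (simp add: \<theta>_def norm_sgn)
    have x_eq: "x = - (norm x *\<^sub>R \<theta>)" using False by (simp add: \<theta>_def sgn_div_norm)
    have "norm x * \<gamma>1 \<theta> \<le> 1" "norm x * \<gamma>2 \<theta> \<le> 1"
      using x x_eq inversion_hull_radial[OF ci(1) \<theta>, of "norm x"]
        inversion_hull_radial[OF ci(2) \<theta>, of "norm x"] by auto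
    then have le: "norm x * max (\<gamma>1 \<theta>) (\<gamma>2 \<theta>) \<le> 1" by (simp add: max_def)
    have "y \<bullet> \<theta> \<le> max (\<gamma>1 \<theta>) (\<gamma>2 \<theta>)" using y \<theta> unfolding wulff_shape_def by blast
    then have "norm x * (y \<bullet> \<theta>) \<le> norm x * max (\<gamma>1 \<theta>) (\<gamma>2 \<theta>)" by (intro mult_left_mono) auto
    moreover have "x \<bullet> y = - (norm x * (y \<bullet> \<theta>))"
      by (subst x_eq) (simp add: inner_commute[of \<theta>])
    ultimately show ?thesis using le by linarith
  qed simp
  then show "y \<in> antipolar (inversion_hull \<gamma>1 \<inter> inversion_hull \<gamma>2)" by (auto simp: antipolar_def)
qed

theorem corollary3:
  fixes \<gamma>1 \<gamma>2 \<gamma>max \<gamma>min :: "real ^ 'n \<Rightarrow> real" and n :: nat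
  assumes "0 < n" and "CARD('n) = n + 1"
    and "convex_integrand \<gamma>1" and "convex_integrand \<gamma>2"
    and "\<And>\<theta>. \<theta> \<in> sphere 0 1 \<Longrightarrow> \<gamma>max \<theta> = max (\<gamma>1 \<theta>) (\<gamma>2 \<theta>)"
    and "\<And>\<theta>. \<theta> \<in> sphere 0 1 \<Longrightarrow> \<gamma>min \<theta> = min (\<gamma>1 \<theta>) (\<gamma>2 \<theta>)"
    and "wulff_shape \<gamma>1 = dual_wulff_shape (wulff_shape \<gamma>2)"
  shows "wulff_shape \<gamma>max = dual_wulff_shape (wulff_shape \<gamma>min)"
proof -
  have pc: "pos_cont_on_sphere \<gamma>1" "pos_cont_on_sphere \<gamma>2"
    using assms(3,4) by (auto simp: convex_integrand_def)
  \<comment> \<open>Duality exchanges the roles: each Wulff shape is the hull of the other integrand.\<close>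
  have W1: "wulff_shape \<gamma>1 = inversion_hull \<gamma>2"
    using assms(7) antipolar_wulff_shape[OF pc(2)] by (simp add: dual_wulff_shape_eq)
  have W2: "wulff_shape \<gamma>2 = inversion_hull \<gamma>1"
    using wulff_shape_eq_antipolar[OF pc(2)] W1 antipolar_wulff_shape[OF pc(1)] by simp
  have "wulff_shape \<gamma>min = wulff_shape \<gamma>1 \<inter> wulff_shape \<gamma>2"
    using assms(6) by (auto simp: wulff_shape_def)
  then have "antipolar (wulff_shape \<gamma>min) = wulff_shape (\<lambda>\<theta>. max (\<gamma>1 \<theta>) (\<gamma>2 \<theta>))"
    using antipolar_inter_inversion_hull[OF assms(3,4)] by (simp add: W1 W2 Int_commute)
  also have "\<dots> = wulff_shape \<gamma>max" using assms(5) by (simp add: wulff_shape_def)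
  finally show ?thesis by (simp add: dual_wulff_shape_eq)
qed

end
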